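(* Let $V\models\mathrm{ZF}+\mathrm{VP}$. Then there is a (definable) permutation $\pi:V\to V$ such that $V_\pi\models\mathrm{VP}+\neg\mathrm{Foundation}$.
   Context: For a definable class permutation $\pi$ of the universe $V$, $V_\pi$ denotes the structure $\langle V,\in_\pi\rangle$ where $x\in_\pi y$ iff $x\in\pi(y)$. VP (Vopěnka's Principle) is the scheme, for each formula $\phi(x)$ of $\{\in\}$: for every set $A$, if $X_\phi=\{x:\phi(x)\}$ is a proper class (i.e. $(\forall x)(\exists y)[(\phi(y)\wedge y\notin x)\vee(\neg\phi(y)\wedge y\in x)]$) of $L_A$-structures, then there are distinct $\mathcal M,\mathcal N\in X_\phi$ and an elementary embedding $f:\mathcal M\to\mathcal N$. Here $L_A$ is the first-order language with equality, a unary predicate $\mathbf U$, a binary predicate $\mathbf R$ and a constant $\mathbf c_a$ for each $a\in A$ (coded as sets: variables $v_n=\langle 0,n\rangle$, constants $\mathbf c_a=\langle 1,a\rangle$, logical symbols and $\mathbf U,\mathbf R$ coded by natural numbers $2,\dots,7$), and an $L_A$-structure is $\langle M,U,R,I\rangle$ with $U\subseteq M$, $R\subseteq M\times M$, $I:A\to M$ interpreting $\mathbf c_a$ as $I(a)$. *)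

theory Defs
  imports Main
begin

section \<open>The language of set theory and its semantics\<close>

text \<open>A model of set theory is a type together with an arbitrary binary relation on it. Only
  schemes and definability refer to the following formulas of the language of membership. Single
  axioms, and all notions defined inside a model, are written as HOL formulas that quantify only
  over the elements of the model and use only its membership relation, so that they
  are first-order formulas evaluated in that model.\<close>

datatype set_fm =
    EqF nat nat
  | MemF nat nat
  | NegF set_fm
  | ConjF set_fm set_fm
  | ExF nat set_fm

primrec holds :: "('v \<Rightarrow> 'v \<Rightarrow> bool) \<Rightarrow> (nat \<Rightarrow> 'v) \<Rightarrow> set_fm \<Rightarrow> bool" where
  "holds E e (EqF i j) \<longleftrightarrow> e i = e j"
| "holds E e (MemF i j) \<longleftrightarrow> E (e i) (e j)"
| "holds E e (NegF \<phi>) \<longleftrightarrow> \<not> holds E e \<phi>"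
| "holds E e (ConjF \<phi> \<psi>) \<longleftrightarrow> holds E e \<phi> \<and> holds E e \<psi>"
| "holds E e (ExF i \<phi>) \<longleftrightarrow> (\<exists>x. holds E (e(i := x)) \<phi>)"

text \<open>Definability of a class permutation is without parameters: the formula defines the graph
  under every assignment. The relation of the permuted model is
  \<open>x \<in>\<^sub>\<pi> y \<longleftrightarrow> x \<in> \<pi>(y)\<close>.\<close>

definition definable_permutation :: "('v \<Rightarrow> 'v \<Rightarrow> bool) \<Rightarrow> ('v \<Rightarrow> 'v) \<Rightarrow> bool" where
  "definable_permutation E \<pi> \<longleftrightarrow>
     bij \<pi> \<and> (\<exists>\<phi>. \<forall>e. holds E e \<phi> \<longleftrightarrow> e 1 = \<pi> (e 0))"

definition permuted :: "('v \<Rightarrow> 'v \<Rightarrow> bool) \<Rightarrow> ('v \<Rightarrow> 'v) \<Rightarrow> 'v \<Rightarrow> 'v \<Rightarrow> bool" where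
  "permuted E \<pi> x y \<longleftrightarrow> E x (\<pi> y)"


context
  fixes mem :: "'v \<Rightarrow> 'v \<Rightarrow> bool"  (infix "\<epsilon>" 50)
begin

section \<open>Basic set-theoretic notions inside a model\<close>

definition subset_of :: "'v \<Rightarrow> 'v \<Rightarrow> bool" where
  "subset_of x y \<longleftrightarrow> (\<forall>z. z \<epsilon> x \<longrightarrow> z \<epsilon> y)"

definition is_empty :: "'v \<Rightarrow> bool" where
  "is_empty x \<longleftrightarrow> (\<forall>z. \<not> z \<epsilon> x)"

definition is_succ :: "'v \<Rightarrow> 'v \<Rightarrow> bool" where
  "is_succ x y \<longleftrightarrow> (\<forall>z. z \<epsilon> y \<longleftrightarrow> z \<epsilon> x \<or> z = x)"

definition is_inductive :: "'v \<Rightarrow> bool" where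
  "is_inductive w \<longleftrightarrow>
     (\<forall>x. is_empty x \<longrightarrow> x \<epsilon> w) \<and> (\<forall>x y. x \<epsilon> w \<and> is_succ x y \<longrightarrow> y \<epsilon> w)"

text \<open>The definition of \<open>\<omega>\<close> as the least inductive set does not depend on Foundation.\<close>

definition is_omega :: "'v \<Rightarrow> bool" where
  "is_omega w \<longleftrightarrow> is_inductive w \<and> (\<forall>w'. is_inductive w' \<longrightarrow> subset_of w w')"

definition is_natural :: "'v \<Rightarrow> bool" where
  "is_natural n \<longleftrightarrow> (\<exists>w. is_omega w \<and> n \<epsilon> w)"

primrec is_numeral :: "nat \<Rightarrow> 'v \<Rightarrow> bool" where
  "is_numeral 0 x \<longleftrightarrow> is_empty x"
| "is_numeral (Suc k) x \<longleftrightarrow> (\<exists>y. is_numeral k y \<and> is_succ y x)"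

definition is_upair :: "'v \<Rightarrow> 'v \<Rightarrow> 'v \<Rightarrow> bool" where
  "is_upair a b p \<longleftrightarrow> (\<forall>z. z \<epsilon> p \<longleftrightarrow> z = a \<or> z = b)"

text \<open>Kuratowski pairs; tuples are \<open>\<langle>a,b,c\<rangle> = \<langle>a,\<langle>b,c\<rangle>\<rangle>\<close> and so on. The last argument is the pair.\<close>

definition is_pair :: "'v \<Rightarrow> 'v \<Rightarrow> 'v \<Rightarrow> bool" where
  "is_pair a b p \<longleftrightarrow> (\<exists>u v. is_upair a a u \<and> is_upair a b v \<and> is_upair u v p)"

definition is_triple :: "'v \<Rightarrow> 'v \<Rightarrow> 'v \<Rightarrow> 'v \<Rightarrow> bool" where
  "is_triple a b c p \<longleftrightarrow> (\<exists>q. is_pair b c q \<and> is_pair a q p)"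

definition is_quadruple :: "'v \<Rightarrow> 'v \<Rightarrow> 'v \<Rightarrow> 'v \<Rightarrow> 'v \<Rightarrow> bool" where
  "is_quadruple a b c d p \<longleftrightarrow> (\<exists>q. is_triple b c d q \<and> is_pair a q p)"

definition related :: "'v \<Rightarrow> 'v \<Rightarrow> 'v \<Rightarrow> bool" where
  "related r x y \<longleftrightarrow> (\<exists>p. is_pair x y p \<and> p \<epsilon> r)"

definition is_relation :: "'v \<Rightarrow> 'v \<Rightarrow> 'v \<Rightarrow> bool" where
  "is_relation r D C \<longleftrightarrow> (\<forall>p. p \<epsilon> r \<longrightarrow> (\<exists>x y. x \<epsilon> D \<and> y \<epsilon> C \<and> is_pair x y p))"

definition is_function :: "'v \<Rightarrow> 'v \<Rightarrow> 'v \<Rightarrow> bool" where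
  "is_function f D C \<longleftrightarrow> is_relation f D C \<and> (\<forall>x. x \<epsilon> D \<longrightarrow> (\<exists>!y. related f x y))"


section \<open>Zermelo-Fraenkel set theory\<close>

definition Extensionality :: bool where
  "Extensionality \<longleftrightarrow> (\<forall>x y. (\<forall>z. z \<epsilon> x \<longleftrightarrow> z \<epsilon> y) \<longrightarrow> x = y)"

definition Foundation :: bool where
  "Foundation \<longleftrightarrow> (\<forall>x. (\<exists>y. y \<epsilon> x) \<longrightarrow> (\<exists>y. y \<epsilon> x \<and> \<not> (\<exists>z. z \<epsilon> x \<and> z \<epsilon> y)))"

definition Pairing :: bool where
  "Pairing \<longleftrightarrow> (\<forall>a b. \<exists>p. is_upair a b p)"

definition Union_Axiom :: bool where
  "Union_Axiom \<longleftrightarrow> (\<forall>x. \<exists>u. \<forall>z. z \<epsilon> u \<longleftrightarrow> (\<exists>y. z \<epsilon> y \<and> y \<epsilon> x))"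

definition Power_Set :: bool where
  "Power_Set \<longleftrightarrow> (\<forall>x. \<exists>p. \<forall>z. z \<epsilon> p \<longleftrightarrow> subset_of z x)"

definition Infinity :: bool where
  "Infinity \<longleftrightarrow> (\<exists>w. (\<exists>x. is_empty x \<and> x \<epsilon> w) \<and>
                    (\<forall>x. x \<epsilon> w \<longrightarrow> (\<exists>y. is_succ x y \<and> y \<epsilon> w)))"

text \<open>In the schemes, the assignment \<open>e\<close> supplies the parameters.\<close>

definition Separation :: bool where
  "Separation \<longleftrightarrow>
     (\<forall>\<phi> e a. \<exists>b. \<forall>x. x \<epsilon> b \<longleftrightarrow> x \<epsilon> a \<and> holds mem (e(0 := x)) \<phi>)"

definition Replacement :: bool where
  "Replacement \<longleftrightarrow>
     (\<forall>\<phi> e a.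
        (\<forall>x y z. x \<epsilon> a \<and> holds mem (e(0 := x, 1 := y)) \<phi> \<and> holds mem (e(0 := x, 1 := z)) \<phi>
           \<longrightarrow> y = z) \<longrightarrow>
        (\<exists>b. \<forall>y. y \<epsilon> b \<longleftrightarrow> (\<exists>x. x \<epsilon> a \<and> holds mem (e(0 := x, 1 := y)) \<phi>)))"

definition ZF :: bool where
  "ZF \<longleftrightarrow> Extensionality \<and> Foundation \<and> Pairing \<and> Union_Axiom \<and> Power_Set \<and> Infinity \<and>
          Separation \<and> Replacement"


section \<open>The languages \<open>L\<^sub>A\<close>, coded inside a model\<close>

text \<open>Variables are \<open>v\<^sub>n = \<langle>0,n\<rangle>\<close> with \<open>n \<in> \<omega>\<close> and constants are \<open>c\<^sub>a = \<langle>1,a\<rangle>\<close> with \<open>a \<in> A\<close>.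
  The symbols equality, negation, conjunction, existential quantifier, \<open>U\<close>, \<open>R\<close> are the
  natural numbers 2, 3, 4, 5, 6, 7, and a formula is the tuple of its leading symbol and its
  immediate constituents. The last argument of the predicates below is the code.\<close>

definition is_variable :: "'v \<Rightarrow> 'v \<Rightarrow> bool" where
  "is_variable n t \<longleftrightarrow> is_natural n \<and> (\<exists>k. is_numeral 0 k \<and> is_pair k n t)"

definition is_constant :: "'v \<Rightarrow> 'v \<Rightarrow> 'v \<Rightarrow> bool" where
  "is_constant A a t \<longleftrightarrow> a \<epsilon> A \<and> (\<exists>k. is_numeral 1 k \<and> is_pair k a t)"

definition is_term :: "'v \<Rightarrow> 'v \<Rightarrow> bool" where
  "is_term A t \<longleftrightarrow> (\<exists>n. is_variable n t) \<or> (\<exists>a. is_constant A a t)"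

definition is_Equal :: "'v \<Rightarrow> 'v \<Rightarrow> 'v \<Rightarrow> bool" where
  "is_Equal t u x \<longleftrightarrow> (\<exists>k. is_numeral 2 k \<and> is_triple k t u x)"

definition is_Not :: "'v \<Rightarrow> 'v \<Rightarrow> bool" where
  "is_Not y x \<longleftrightarrow> (\<exists>k. is_numeral 3 k \<and> is_pair k y x)"

definition is_And :: "'v \<Rightarrow> 'v \<Rightarrow> 'v \<Rightarrow> bool" where
  "is_And y z x \<longleftrightarrow> (\<exists>k. is_numeral 4 k \<and> is_triple k y z x)"

definition is_Exists :: "'v \<Rightarrow> 'v \<Rightarrow> 'v \<Rightarrow> bool" where
  "is_Exists n y x \<longleftrightarrow> (\<exists>k v. is_numeral 5 k \<and> is_variable n v \<and> is_triple k v y x)"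

definition is_U :: "'v \<Rightarrow> 'v \<Rightarrow> bool" where
  "is_U t x \<longleftrightarrow> (\<exists>k. is_numeral 6 k \<and> is_pair k t x)"

definition is_R :: "'v \<Rightarrow> 'v \<Rightarrow> 'v \<Rightarrow> bool" where
  "is_R t u x \<longleftrightarrow> (\<exists>k. is_numeral 7 k \<and> is_triple k t u x)"

definition formula_closed :: "'v \<Rightarrow> 'v \<Rightarrow> bool" where
  "formula_closed A F \<longleftrightarrow>
     (\<forall>t u x. is_term A t \<and> is_term A u \<and> is_Equal t u x \<longrightarrow> x \<epsilon> F) \<and>
     (\<forall>t x. is_term A t \<and> is_U t x \<longrightarrow> x \<epsilon> F) \<and>
     (\<forall>t u x. is_term A t \<and> is_term A u \<and> is_R t u x \<longrightarrow> x \<epsilon> F) \<and>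
     (\<forall>y x. y \<epsilon> F \<and> is_Not y x \<longrightarrow> x \<epsilon> F) \<and>
     (\<forall>y z x. y \<epsilon> F \<and> z \<epsilon> F \<and> is_And y z x \<longrightarrow> x \<epsilon> F) \<and>
     (\<forall>n y x. y \<epsilon> F \<and> is_Exists n y x \<longrightarrow> x \<epsilon> F)"

definition is_formula_set :: "'v \<Rightarrow> 'v \<Rightarrow> bool" where
  "is_formula_set A F \<longleftrightarrow>
     formula_closed A F \<and> (\<forall>G. formula_closed A G \<longrightarrow> subset_of F G)"


section \<open>\<open>L\<^sub>A\<close>-structures, satisfaction and elementary embeddings\<close>

definition is_structure :: "'v \<Rightarrow> 'v \<Rightarrow> 'v \<Rightarrow> 'v \<Rightarrow> 'v \<Rightarrow> 'v \<Rightarrow> bool" where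
  "is_structure A M U R I S \<longleftrightarrow>
     is_quadruple M U R I S \<and> subset_of U M \<and> is_relation R M M \<and> is_function I A M"

text \<open>The domain of a structure may be empty. Therefore assignments are partial functions
  from \<open>\<omega>\<close> to the domain (otherwise the empty structure would have no assignments, not even for
  sentences). An atomic formula with an undefined variable counts as false; satisfaction of a
  formula under an assignment defined on its free variables is the usual one.\<close>

definition is_assignment :: "'v \<Rightarrow> 'v \<Rightarrow> bool" where
  "is_assignment M s \<longleftrightarrow>
     (\<forall>p. p \<epsilon> s \<longrightarrow> (\<exists>n a. is_natural n \<and> a \<epsilon> M \<and> is_pair n a p)) \<and>
     (\<forall>n a b. related s n a \<and> related s n b \<longrightarrow> a = b)"

definition is_update :: "'v \<Rightarrow> 'v \<Rightarrow> 'v \<Rightarrow> 'v \<Rightarrow> 'v \<Rightarrow> bool" where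
  "is_update M s n a s' \<longleftrightarrow> is_assignment M s' \<and>
     (\<forall>k b. related s' k b \<longleftrightarrow> (if k = n then b = a else related s k b))"

definition is_value :: "'v \<Rightarrow> 'v \<Rightarrow> 'v \<Rightarrow> 'v \<Rightarrow> 'v \<Rightarrow> bool" where
  "is_value A I s t a \<longleftrightarrow>
     (\<exists>n. is_variable n t \<and> related s n a) \<or> (\<exists>c. is_constant A c t \<and> related I c a)"

text \<open>Tarski's clauses: \<open>T\<close> is the satisfaction relation of \<open>\<langle>M,U,R,I\<rangle>\<close>, as a set of pairs of a
  formula in \<open>F\<close> and an assignment.\<close>

definition is_satisfaction ::
    "'v \<Rightarrow> 'v \<Rightarrow> 'v \<Rightarrow> 'v \<Rightarrow> 'v \<Rightarrow> 'v \<Rightarrow> 'v \<Rightarrow> bool" where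
  "is_satisfaction A F M U R I T \<longleftrightarrow>
     (\<forall>x s. x \<epsilon> F \<and> is_assignment M s \<longrightarrow>
       (\<forall>t u. is_Equal t u x \<longrightarrow>
          (related T x s \<longleftrightarrow> (\<exists>a b. is_value A I s t a \<and> is_value A I s u b \<and> a = b))) \<and>
       (\<forall>t. is_U t x \<longrightarrow>
          (related T x s \<longleftrightarrow> (\<exists>a. is_value A I s t a \<and> a \<epsilon> U))) \<and>
       (\<forall>t u. is_R t u x \<longrightarrow>
          (related T x s \<longleftrightarrow> (\<exists>a b. is_value A I s t a \<and> is_value A I s u b \<and> related R a b))) \<and>
       (\<forall>y. is_Not y x \<longrightarrow>
          (related T x s \<longleftrightarrow> \<not> related T y s)) \<and>
       (\<forall>y z. is_And y z x \<longrightarrow>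
          (related T x s \<longleftrightarrow> related T y s \<and> related T z s)) \<and>
       (\<forall>n y. is_Exists n y x \<longrightarrow>
          (related T x s \<longleftrightarrow> (\<exists>a s'. a \<epsilon> M \<and> is_update M s n a s' \<and> related T y s'))))"

definition is_composition :: "'v \<Rightarrow> 'v \<Rightarrow> 'v \<Rightarrow> 'v \<Rightarrow> bool" where
  "is_composition N f s s' \<longleftrightarrow> is_assignment N s' \<and>
     (\<forall>n b. related s' n b \<longleftrightarrow> (\<exists>a. related s n a \<and> related f a b))"

definition elementary_embedding :: "'v \<Rightarrow> 'v \<Rightarrow> 'v \<Rightarrow> 'v \<Rightarrow> bool" where
  "elementary_embedding A S S' f \<longleftrightarrow>
     (\<exists>M U R I M' U' R' I' F T T'.
        is_structure A M U R I S \<and> is_structure A M' U' R' I' S' \<and>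
        is_function f M M' \<and>
        is_formula_set A F \<and>
        is_satisfaction A F M U R I T \<and> is_satisfaction A F M' U' R' I' T' \<and>
        (\<forall>x s s'. x \<epsilon> F \<and> is_assignment M s \<and> is_composition M' f s s' \<longrightarrow>
           (related T x s \<longleftrightarrow> related T' x s')))"


section \<open>Vopenka's Principle\<close>

definition proper_class :: "('v \<Rightarrow> bool) \<Rightarrow> bool" where
  "proper_class X \<longleftrightarrow> (\<forall>x. \<exists>y. (X y \<and> \<not> y \<epsilon> x) \<or> (\<not> X y \<and> y \<epsilon> x))"

text \<open>As in the axiom schemes of ZF, formulas may contain parameters, given by \<open>e\<close>.\<close>

definition VP :: bool where
  "VP \<longleftrightarrow>
     (\<forall>\<phi> e A.
        let X = (\<lambda>x. holds mem (e(0 := x)) \<phi>) in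
        proper_class X \<and> (\<forall>S. X S \<longrightarrow> (\<exists>M U R I. is_structure A M U R I S)) \<longrightarrow>
        (\<exists>S S' f. X S \<and> X S' \<and> S \<noteq> S' \<and> elementary_embedding A S S' f))"

end

end

theory Submission
  imports Defs "HOL-Combinatorics.Transposition"
begin

text \<open>
  Let \<open>\<pi>\<close> exchange \<open>V\<^sub>3\<close> and \<open>V\<^sub>4 = \<P>(V\<^sub>3)\<close>. In \<open>V\<^sub>\<pi>\<close> the set \<open>V\<^sub>3\<close> is an element of itself, so
  Foundation fails. Both sets contain \<open>0\<close>, \<open>{0}\<close> and \<open>{{0}}\<close>, hence neither of them
  has at most two elements, is a natural number or \<open>\<omega>\<close>, or is a set of ordered pairs. Therefore
  \<open>V\<close> and \<open>V\<^sub>\<pi>\<close> have the same ordered pairs, natural numbers, codes of formulas and assignments,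
  and every notion of \<open>V\<^sub>\<pi>\<close> that occurs in Vopenka's Principle becomes the corresponding notion of
  \<open>V\<close> when \<open>\<pi>\<close> is applied to those arguments whose elements matter. So
  \<open>\<langle>M,U,R,I\<rangle> \<mapsto> \<langle>\<pi>(M),\<pi>(U),\<pi>(R),\<pi>(I)\<rangle>\<close> is a definable injection that turns a proper class of
  \<open>L\<^sub>A\<close>-structures of \<open>V\<^sub>\<pi>\<close> into a proper class of \<open>L\<close>-structures of \<open>V\<close>, with constants indexed
  by \<open>\<pi>(A)\<close>, and an elementary embedding \<open>f\<close> found in \<open>V\<close> is the embedding \<open>\<pi>(f)\<close> of \<open>V\<^sub>\<pi>\<close>.
\<close>

section \<open>Formulas expressing the basic notions\<close>

definition DisjF :: "set_fm \<Rightarrow> set_fm \<Rightarrow> set_fm" where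
  "DisjF \<phi> \<psi> = NegF (ConjF (NegF \<phi>) (NegF \<psi>))"

definition ImpF :: "set_fm \<Rightarrow> set_fm \<Rightarrow> set_fm" where
  "ImpF \<phi> \<psi> = NegF (ConjF \<phi> (NegF \<psi>))"

definition IffF :: "set_fm \<Rightarrow> set_fm \<Rightarrow> set_fm" where
  "IffF \<phi> \<psi> = ConjF (ImpF \<phi> \<psi>) (ImpF \<psi> \<phi>)"

definition AllF :: "nat \<Rightarrow> set_fm \<Rightarrow> set_fm" where
  "AllF i \<phi> = NegF (ExF i (NegF \<phi>))"

lemma holds_connectives [simp]:
  "holds E e (DisjF \<phi> \<psi>) \<longleftrightarrow> holds E e \<phi> \<or> holds E e \<psi>"
  "holds E e (ImpF \<phi> \<psi>) \<longleftrightarrow> (holds E e \<phi> \<longrightarrow> holds E e \<psi>)"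
  "holds E e (IffF \<phi> \<psi>) \<longleftrightarrow> (holds E e \<phi> \<longleftrightarrow> holds E e \<psi>)"
  "holds E e (AllF i \<phi>) \<longleftrightarrow> (\<forall>x. holds E (e(i := x)) \<phi>)"
  by (auto simp: DisjF_def ImpF_def IffF_def AllF_def)

text \<open>The last argument \<open>n\<close> of the formulas below is a bound on their free variables: the variables
  from \<open>n\<close> on serve as bound variables.\<close>

definition emptyF :: "nat \<Rightarrow> nat \<Rightarrow> set_fm" where
  "emptyF i n = NegF (ExF n (MemF n i))"

definition subsetF :: "nat \<Rightarrow> nat \<Rightarrow> nat \<Rightarrow> set_fm" where
  "subsetF i j n = AllF n (ImpF (MemF n i) (MemF n j))"

definition powerF :: "nat \<Rightarrow> nat \<Rightarrow> nat \<Rightarrow> set_fm" where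
  "powerF i j n = AllF n (IffF (MemF n j) (subsetF n i (n + 1)))"

definition succF :: "nat \<Rightarrow> nat \<Rightarrow> nat \<Rightarrow> set_fm" where
  "succF i j n = AllF n (IffF (MemF n j) (DisjF (MemF n i) (EqF n i)))"

definition inductiveF :: "nat \<Rightarrow> nat \<Rightarrow> set_fm" where
  "inductiveF w n =
     ConjF (AllF n (ImpF (emptyF n (n + 1)) (MemF n w)))
       (AllF n (AllF (n + 1)
         (ImpF (ConjF (MemF n w) (succF n (n + 1) (n + 2))) (MemF (n + 1) w))))"

definition upairF :: "nat \<Rightarrow> nat \<Rightarrow> nat \<Rightarrow> nat \<Rightarrow> set_fm" where
  "upairF i j k n = AllF n (IffF (MemF n k) (DisjF (EqF n i) (EqF n j)))"

definition pairF :: "nat \<Rightarrow> nat \<Rightarrow> nat \<Rightarrow> nat \<Rightarrow> set_fm" where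
  "pairF i j k n = ExF n (ExF (n + 1) (ConjF (upairF i i n (n + 2))
     (ConjF (upairF i j (n + 1) (n + 2)) (upairF n (n + 1) k (n + 2)))))"

definition quadrupleF :: "nat \<Rightarrow> nat \<Rightarrow> nat \<Rightarrow> nat \<Rightarrow> nat \<Rightarrow> nat \<Rightarrow> set_fm" where
  "quadrupleF i j k l m n = ExF n (ExF (n + 1)
     (ConjF (pairF k l (n + 1) (n + 2))
       (ConjF (pairF j (n + 1) n (n + 2)) (pairF i n m (n + 2)))))"

definition is_power :: "('v \<Rightarrow> 'v \<Rightarrow> bool) \<Rightarrow> 'v \<Rightarrow> 'v \<Rightarrow> bool" where
  "is_power E x y \<longleftrightarrow> (\<forall>z. E z y \<longleftrightarrow> subset_of E z x)"

text \<open>The set described is the level \<open>V\<^sub>k\<close> of the cumulative hierarchy. The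
  index is a number of the metatheory, so each instance is a first-order formula, which
  \<open>levelF\<close> writes out.\<close>

primrec is_level :: "('v \<Rightarrow> 'v \<Rightarrow> bool) \<Rightarrow> nat \<Rightarrow> 'v \<Rightarrow> bool" where
  "is_level E 0 x \<longleftrightarrow> is_empty E x"
| "is_level E (Suc k) x \<longleftrightarrow> (\<exists>y. is_level E k y \<and> is_power E y x)"

primrec levelF :: "nat \<Rightarrow> nat \<Rightarrow> nat \<Rightarrow> set_fm" where
  "levelF 0 i n = emptyF i n"
| "levelF (Suc k) i n = ExF n (ConjF (levelF k n (n + 1)) (powerF n i (n + 1)))"

context
  fixes E :: "'v \<Rightarrow> 'v \<Rightarrow> bool" and e :: "nat \<Rightarrow> 'v"
begin

lemma holds_emptyF [simp]: "i < n \<Longrightarrow> holds E e (emptyF i n) \<longleftrightarrow> is_empty E (e i)"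
  by (simp add: emptyF_def is_empty_def)

lemma holds_powerF [simp]:
  "\<lbrakk>i < n; j < n\<rbrakk> \<Longrightarrow> holds E e (powerF i j n) \<longleftrightarrow> is_power E (e i) (e j)"
  by (simp add: powerF_def subsetF_def is_power_def subset_of_def)

lemma holds_inductiveF [simp]:
  "w < n \<Longrightarrow> holds E e (inductiveF w n) \<longleftrightarrow> is_inductive E (e w)"
  by (simp add: inductiveF_def emptyF_def succF_def is_inductive_def is_succ_def is_empty_def)

lemma holds_pairF [simp]:
  "\<lbrakk>i < n; j < n; k < n\<rbrakk> \<Longrightarrow> holds E e (pairF i j k n) \<longleftrightarrow> is_pair E (e i) (e j) (e k)"
  by (simp add: pairF_def upairF_def is_pair_def is_upair_def)

end

lemma holds_quadrupleF [simp]: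
  "\<lbrakk>i < n; j < n; k < n; l < n; m < n\<rbrakk> \<Longrightarrow>
     holds E e (quadrupleF i j k l m n) \<longleftrightarrow> is_quadruple E (e i) (e j) (e k) (e l) (e m)"
  by (auto simp: quadrupleF_def is_quadruple_def is_triple_def)

lemma holds_levelF [simp]: "i < n \<Longrightarrow> holds E e (levelF k i n) \<longleftrightarrow> is_level E k (e i)"
  by (induction k arbitrary: i n e) simp_all

primrec var_bound :: "set_fm \<Rightarrow> nat" where
  "var_bound (EqF i j) = Suc (max i j)"
| "var_bound (MemF i j) = Suc (max i j)"
| "var_bound (NegF \<phi>) = var_bound \<phi>"
| "var_bound (ConjF \<phi> \<psi>) = max (var_bound \<phi>) (var_bound \<psi>)"
| "var_bound (ExF i \<phi>) = max (Suc i) (var_bound \<phi>)"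

text \<open>The coincidence lemma. In the case of \<open>ExF\<close> both assignments are updated at
  the same variable and so still agree below the bound.\<close>

lemma holds_cong:
  "(\<And>i. i < var_bound \<phi> \<Longrightarrow> e i = e' i) \<Longrightarrow> holds E e \<phi> \<longleftrightarrow> holds E e' \<phi>"
proof (induction \<phi> arbitrary: e e')
  case (ExF i \<phi>)
  then have "holds E (e(i := x)) \<phi> \<longleftrightarrow> holds E (e'(i := x)) \<phi>" for x
    by (intro ExF.IH) simp
  then show ?case by simp
next
  case (NegF \<phi>)
  then show ?case by (metis holds.simps(3) var_bound.simps(3))
next
  case (ConjF \<phi> \<psi>)
  then show ?case by (metis holds.simps(4) var_bound.simps(4) less_max_iff_disj)
qed auto


section \<open>Models of ZF and the exchange of two levels\<close>

locale zf_model =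
  fixes mem :: "'v \<Rightarrow> 'v \<Rightarrow> bool"  (infix "\<epsilon>" 50)
  assumes ZF: "ZF mem"
begin

section \<open>Existence and uniqueness of finite levels, pairs and quadruples\<close>

lemma ext: "(\<And>z. z \<epsilon> x \<longleftrightarrow> z \<epsilon> y) \<Longrightarrow> x = y"
  using ZF unfolding ZF_def Extensionality_def by blast

lemma separation: "\<exists>b. \<forall>x. x \<epsilon> b \<longleftrightarrow> x \<epsilon> a \<and> holds mem (e(0 := x)) \<phi>"
  using ZF unfolding ZF_def Separation_def by blast

lemma replacement:
  assumes "\<And>x y z. x \<epsilon> a \<Longrightarrow> holds mem (e(0 := x, 1 := y)) \<phi> \<Longrightarrow>
    holds mem (e(0 := x, 1 := z)) \<phi> \<Longrightarrow> y = z"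
  shows "\<exists>b. \<forall>y. y \<epsilon> b \<longleftrightarrow> (\<exists>x. x \<epsilon> a \<and> holds mem (e(0 := x, 1 := y)) \<phi>)"
proof -
  have "Replacement mem" using ZF by (simp add: ZF_def)
  then show ?thesis using assms unfolding Replacement_def by blast
qed

lemma ex_upair: "\<exists>p. is_upair mem a b p"
  using ZF unfolding ZF_def Pairing_def by blast

lemma ex_power: "\<exists>y. is_power mem x y"
  using ZF unfolding ZF_def Power_Set_def is_power_def by blast

lemma ex_empty: "\<exists>x. is_empty mem x"
  using ZF unfolding ZF_def Infinity_def by blast

lemma ex_level: "\<exists>x. is_level mem k x"
proof (induction k)
  case 0
  show ?case using ex_empty by simp
next
  case (Suc k)
  then show ?case using ex_power by simp blast
qed

lemma empty_unique: "is_empty mem x \<Longrightarrow> is_empty mem y \<Longrightarrow> x = y"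
  by (intro ext) (simp add: is_empty_def)

lemma succ_unique: "is_succ mem x y \<Longrightarrow> is_succ mem x z \<Longrightarrow> y = z"
  by (intro ext) (simp add: is_succ_def)

lemma power_unique: "is_power mem x y \<Longrightarrow> is_power mem x z \<Longrightarrow> y = z"
  by (intro ext) (simp add: is_power_def)

lemma level_unique: "is_level mem k x \<Longrightarrow> is_level mem k y \<Longrightarrow> x = y"
  by (induction k arbitrary: x y) (auto dest: empty_unique power_unique)

lemma upair_unique: "is_upair mem a b p \<Longrightarrow> is_upair mem a b q \<Longrightarrow> p = q"
  by (intro ext) (simp add: is_upair_def)

lemma upair_inject:
  "is_upair mem a b p \<Longrightarrow> is_upair mem c d p \<Longrightarrow> a = c \<and> b = d \<or> a = d \<and> b = c"
  unfolding is_upair_def by metis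

lemma ex_pair: "\<exists>p. is_pair mem a b p"
  using ex_upair unfolding is_pair_def by metis

lemma pair_unique: "is_pair mem a b p \<Longrightarrow> is_pair mem a b q \<Longrightarrow> p = q"
  unfolding is_pair_def by (metis upair_unique)

lemma pair_inject: "is_pair mem a b p \<Longrightarrow> is_pair mem c d p \<Longrightarrow> a = c \<and> b = d"
  unfolding is_pair_def by (metis upair_inject)

lemma ex_quadruple: "\<exists>p. is_quadruple mem a b c d p"
  using ex_pair unfolding is_quadruple_def is_triple_def by metis

lemma quadruple_unique:
  "is_quadruple mem a b c d p \<Longrightarrow> is_quadruple mem a b c d q \<Longrightarrow> p = q"
  unfolding is_quadruple_def is_triple_def by (metis pair_unique)

lemma quadruple_inject:
  "is_quadruple mem a b c d p \<Longrightarrow> is_quadruple mem a' b' c' d' p \<Longrightarrow>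
     a = a' \<and> b = b' \<and> c = c' \<and> d = d'"
  unfolding is_quadruple_def is_triple_def by (metis pair_inject)

section \<open>The set \<omega> and induction over it\<close>

lemma ex_omega: "\<exists>w. is_omega mem w"
proof -
  obtain v z where v: "z \<epsilon> v" "is_empty mem z"
    "\<And>x. x \<epsilon> v \<Longrightarrow> \<exists>y. is_succ mem x y \<and> y \<epsilon> v"
    using ZF unfolding ZF_def Infinity_def by blast
  \<comment> \<open>Infinity supplies one empty element and one successor of each element; by
    uniqueness there are no others.\<close>
  have ind: "is_inductive mem v"
    unfolding is_inductive_def using v empty_unique succ_unique by blast
  \<comment> \<open>The intersection of all inductive sets, cut out of \<open>v\<close>. Its formula
    has 0 as its only free variable, which allows the assignment \<open>undefined\<close>.\<close>
  obtain w where w: "\<And>x. x \<epsilon> w \<longleftrightarrow> x \<epsilon> v \<and> (\<forall>u. is_inductive mem u \<longrightarrow> x \<epsilon> u)"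
    using separation[of v undefined "AllF 1 (ImpF (inductiveF 1 2) (MemF 0 1))"] by auto
  have "is_inductive mem w"
    using ind unfolding is_inductive_def w by blast
  then have "is_omega mem w"
    unfolding is_omega_def subset_of_def by (simp add: w)
  then show ?thesis ..
qed

lemma empty_in_omega: "is_omega mem w \<Longrightarrow> is_empty mem x \<Longrightarrow> x \<epsilon> w"
  by (simp add: is_omega_def is_inductive_def)

lemma succ_in_omega: "is_omega mem w \<Longrightarrow> x \<epsilon> w \<Longrightarrow> is_succ mem x y \<Longrightarrow> y \<epsilon> w"
  unfolding is_omega_def is_inductive_def by blast

text \<open>Separation is a scheme, so the property has to be given by a formula; \<open>e\<close>
  carries the parameters.\<close>

lemma omega_induct:
  assumes w: "is_omega mem w" and n: "n \<epsilon> w"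
    and empty: "\<And>x. is_empty mem x \<Longrightarrow> holds mem (e(0 := x)) \<phi>"
    and succ: "\<And>x y. x \<epsilon> w \<Longrightarrow> holds mem (e(0 := x)) \<phi> \<Longrightarrow> is_succ mem x y \<Longrightarrow>
      holds mem (e(0 := y)) \<phi>"
  shows "holds mem (e(0 := n)) \<phi>"
proof -
  obtain v where v: "\<And>x. x \<epsilon> v \<longleftrightarrow> x \<epsilon> w \<and> holds mem (e(0 := x)) \<phi>"
    using separation by metis
  have "is_inductive mem v"
    unfolding is_inductive_def v
    using empty_in_omega[OF w] succ_in_omega[OF w] empty succ by meson
  then show ?thesis
    using w n v unfolding is_omega_def subset_of_def by meson
qed

section \<open>Sets that do not contain all of 0, {0} and {{0}}\<close>

definition wide :: "'v \<Rightarrow> bool" where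
  "wide y \<longleftrightarrow> (\<exists>z a b. is_empty mem z \<and> is_upair mem z z a \<and> is_upair mem a a b \<and>
     z \<epsilon> y \<and> a \<epsilon> y \<and> b \<epsilon> y)"

lemma not_wide_empty: "is_empty mem x \<Longrightarrow> \<not> wide x"
  by (auto simp: wide_def is_empty_def)

lemma not_wide_upair: "is_upair mem a b p \<Longrightarrow> \<not> wide p"
  unfolding wide_def is_upair_def is_empty_def by metis

text \<open>The element 0 would have to be an ordered pair, but these are never empty.\<close>

lemma not_wide_assignment: "is_assignment mem M s \<Longrightarrow> \<not> wide s"
  unfolding is_assignment_def wide_def is_pair_def is_upair_def is_empty_def by metis

lemma ex_double_singleton:
  obtains z a b where "is_empty mem z" "is_upair mem z z a" "is_upair mem a a b"
  using ex_empty ex_upair by metis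

text \<open>If {{0}} were the successor of \<open>x\<close>, then \<open>x\<close> would be {0}, and
  its element 0 would also be an element of {{0}}, so that 0 = {0}.\<close>

lemma double_singleton_not_succ:
  assumes "is_empty mem z" "is_upair mem z z a" "is_upair mem a a b"
  shows "\<not> is_succ mem x b"
  using assms unfolding is_empty_def is_upair_def is_succ_def by metis

lemma double_singleton_notin_omega:
  assumes w: "is_omega mem w"
    and b: "is_empty mem z" "is_upair mem z z a" "is_upair mem a a b"
  shows "\<not> b \<epsilon> w"
proof
  assume "b \<epsilon> w"
  have "\<not> is_empty mem b"
    using b(3) by (auto simp: is_empty_def is_upair_def)
  \<comment> \<open>Variable 1 holds \<open>b\<close>, and induction shows that every element of
    \<open>w\<close> differs from it: \<open>b\<close> is neither empty nor a successor.\<close>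
  then show False
    using omega_induct[OF w \<open>b \<epsilon> w\<close>, of "\<lambda>_. b" "NegF (EqF 0 1)"] double_singleton_not_succ[OF b]
    by auto
qed

lemma not_wide_omega: "is_omega mem w \<Longrightarrow> \<not> wide w"
  unfolding wide_def using double_singleton_notin_omega by blast

text \<open>The element {{0}} is missing: a successor gains only its predecessor as a new element,
  which lies in \<omega>, while {{0}} does not.\<close>

lemma not_wide_natural:
  assumes w: "is_omega mem w" and n: "n \<epsilon> w"
  shows "\<not> wide n"
proof -
  obtain z a b where b: "is_empty mem z" "is_upair mem z z a" "is_upair mem a a b"
    by (rule ex_double_singleton)
  have "\<not> b \<epsilon> w"
    by (rule double_singleton_notin_omega[OF w b])
  then have "\<not> b \<epsilon> n"
    using omega_induct[OF w n, of "\<lambda>_. b" "NegF (MemF 1 0)"]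
    by (auto simp: is_empty_def is_succ_def)
  then show ?thesis
    unfolding wide_def using b empty_unique upair_unique by metis
qed

lemma numeral_in_omega: "is_omega mem w \<Longrightarrow> is_numeral mem k x \<Longrightarrow> x \<epsilon> w"
  by (induction k arbitrary: x) (auto intro: empty_in_omega succ_in_omega)

lemma not_wide_numeral: "is_numeral mem k x \<Longrightarrow> \<not> wide x"
  using ex_omega numeral_in_omega not_wide_natural by blast

text \<open>0 is a subset of every set, and {0} and {{0}} are subsets of \<open>x\<close> because 0
  and {0} are elements of it.\<close>

lemma wide_power:
  assumes "is_empty mem z" "is_upair mem z z a" "z \<epsilon> x" "a \<epsilon> x" "is_power mem x y"
  shows "wide y"
proof -
  obtain b where "is_upair mem a a b" using ex_upair by blast
  then show ?thesis
    using assms unfolding wide_def is_power_def subset_of_def is_upair_def is_empty_def by metis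
qed

lemma power_wide:
  assumes "wide x" "is_power mem x y"
  shows "wide y"
  using assms wide_power unfolding wide_def by blast

text \<open>In the proof \<open>z\<close>, \<open>u\<close> and \<open>v\<close> are the levels 0, 1
  and 2. Level 2 contains 0 and {0}, so its power set is wide. The levels before have at most two
  elements, so level 3 is the first wide one.\<close>

lemma wide_level_3:
  assumes "is_level mem 3 x"
  shows "wide x"
proof -
  obtain z a where a: "is_empty mem z" "is_upair mem z z a"
    using ex_double_singleton by blast
  obtain u v where u: "is_power mem z u" and v: "is_power mem u v" and x: "is_power mem v x"
    using assms a(1) empty_unique by (auto simp: numeral_3_eq_3)
  have z: "z \<epsilon> t" if "is_power mem y t" for y t
    using that a(1) by (simp add: is_power_def subset_of_def is_empty_def)
  have "a \<epsilon> v"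
    using z[OF u] a(2) v by (simp add: is_power_def subset_of_def is_upair_def)
  then show ?thesis
    using wide_power[OF a z[OF v] _ x] by simp
qed

end

section \<open>The exchange of \<open>V\<^sub>3\<close> and \<open>V\<^sub>4\<close>, and the
  failure of Foundation\<close>

locale level_swap = zf_model mem for mem :: "'v \<Rightarrow> 'v \<Rightarrow> bool"  (infix "\<epsilon>" 50) +
  fixes p q :: 'v
  assumes p: "is_level mem 3 p" and q: "is_power mem p q"
begin

definition \<pi> :: "'v \<Rightarrow> 'v" where "\<pi> = transpose p q"

lemma \<pi>_\<pi> [simp]: "\<pi> (\<pi> x) = x"
  by (simp add: \<pi>_def)

lemma \<pi>_eq_iff [simp]: "\<pi> x = \<pi> y \<longleftrightarrow> x = y"
  by (metis \<pi>_\<pi>)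

lemma all_\<pi>: "(\<forall>x. P (\<pi> x)) \<longleftrightarrow> (\<forall>x. P x)"
  by (metis \<pi>_\<pi>)

lemma level_4_iff: "is_level mem 4 x \<longleftrightarrow> x = q"
proof
  have "is_level mem 4 q"
    using p q by (auto simp: eval_nat_numeral)
  then show "is_level mem 4 x \<Longrightarrow> x = q" "x = q \<Longrightarrow> is_level mem 4 x"
    using level_unique by blast+
qed

lemma level_3_iff: "is_level mem 3 x \<longleftrightarrow> x = p"
  using p level_unique by blast

text \<open>Both sets that are moved are wide: \<open>p\<close> as level 3, and \<open>q\<close> as
  the power set of a wide set.\<close>

lemma \<pi>_not_wide: "\<not> wide x \<Longrightarrow> \<pi> x = x"
  using wide_level_3[OF p] power_wide[OF _ q] unfolding \<pi>_def transpose_def by auto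

text \<open>Whichever side holds, its argument is not wide and hence fixed. This cancels
  \<open>\<pi>\<close> in notions that never hold of wide sets.\<close>

lemma not_wide_\<pi>:
  assumes "\<And>x. P x \<Longrightarrow> \<not> wide x"
  shows "P (\<pi> x) \<longleftrightarrow> P x"
  using assms \<pi>_not_wide by (metis \<pi>_\<pi>)

text \<open>The two sets are described as levels instead of being named by parameters, because the
  permutation has to be definable without parameters.\<close>

definition swapF :: "nat \<Rightarrow> nat \<Rightarrow> nat \<Rightarrow> set_fm" where
  "swapF i j n = DisjF (ConjF (levelF 3 i n) (levelF 4 j n))
     (DisjF (ConjF (levelF 4 i n) (levelF 3 j n))
       (ConjF (ConjF (NegF (levelF 3 i n)) (NegF (levelF 4 i n))) (EqF j i)))"

lemma holds_swapF [simp]: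
  "\<lbrakk>i < n; j < n\<rbrakk> \<Longrightarrow> holds mem e (swapF i j n) \<longleftrightarrow> e j = \<pi> (e i)"
  by (auto simp: swapF_def level_3_iff level_4_iff \<pi>_def transpose_def)

lemma definable_permutation_\<pi>: "definable_permutation mem \<pi>"
proof -
  have "bij \<pi>" by (simp add: \<pi>_def)
  moreover have "\<forall>e. holds mem e (swapF 0 1 2) \<longleftrightarrow> e 1 = \<pi> (e 0)" by simp
  ultimately show ?thesis unfolding definable_permutation_def by blast
qed

abbreviation mem_\<pi> :: "'v \<Rightarrow> 'v \<Rightarrow> bool" where
  "mem_\<pi> \<equiv> permuted mem \<pi>"

lemma not_Foundation_\<pi>: "\<not> Foundation mem_\<pi>"
proof -
  \<comment> \<open>The counterexample is the singleton of \<open>p\<close>, which has the same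
    single element in both models.\<close>
  obtain x where x: "is_upair mem p p x" using ex_upair by blast
  have "\<pi> x = x" using not_wide_upair[OF x] by (rule \<pi>_not_wide)
  then have "mem_\<pi> y x \<longleftrightarrow> y = p" for y
    using x by (simp add: permuted_def is_upair_def)
  \<comment> \<open>\<open>\<pi>\<close> maps \<open>p\<close> to its power set \<open>q\<close>,
    and \<open>p\<close> is an element of that.\<close>
  moreover have "mem_\<pi> p p"
    using q by (simp add: permuted_def \<pi>_def is_power_def subset_of_def)
  ultimately show ?thesis
    unfolding Foundation_def by (auto intro: exI[of _ x])
qed


section \<open>Absoluteness\<close>

text \<open>Only the set on the right is moved. In the rules below \<open>\<pi>\<close> therefore
  appears at arguments whose elements are consulted, unless they are never wide, and not at those
  that occur merely as elements.\<close>

lemma permuted_iff: "mem_\<pi> x y \<longleftrightarrow> x \<epsilon> \<pi> y"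
  by (simp add: permuted_def)

lemma subset_of_\<pi>: "subset_of mem_\<pi> x y \<longleftrightarrow> subset_of mem (\<pi> x) (\<pi> y)"
  by (simp add: subset_of_def permuted_iff)

lemma is_empty_\<pi>: "is_empty mem_\<pi> x \<longleftrightarrow> is_empty mem x"
  using not_wide_\<pi>[OF not_wide_empty] by (simp add: is_empty_def permuted_iff)

lemma is_upair_\<pi>: "is_upair mem_\<pi> a b x \<longleftrightarrow> is_upair mem a b x"
  using not_wide_\<pi>[OF not_wide_upair] by (simp add: is_upair_def permuted_iff)

lemma is_pair_\<pi>: "is_pair mem_\<pi> a b x \<longleftrightarrow> is_pair mem a b x"
  by (simp add: is_pair_def is_upair_\<pi>)

lemma is_quadruple_\<pi>: "is_quadruple mem_\<pi> a b c d x \<longleftrightarrow> is_quadruple mem a b c d x"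
  by (simp add: is_quadruple_def is_triple_def is_pair_\<pi>)

lemma is_triple_\<pi>: "is_triple mem_\<pi> a b c x \<longleftrightarrow> is_triple mem a b c x"
  by (simp add: is_triple_def is_pair_\<pi>)

text \<open>Here \<open>x\<close> occurs both as a set, that is as \<open>\<pi> x\<close>, and as an
  element, that is as \<open>x\<close> itself; the condition makes the two agree.\<close>

lemma is_succ_\<pi>: "is_succ mem_\<pi> x y \<longleftrightarrow> is_succ mem (\<pi> x) (\<pi> y)" if "\<pi> x = x"
  using that by (simp add: is_succ_def permuted_iff)

lemma is_numeral_\<pi>: "is_numeral mem_\<pi> k x \<longleftrightarrow> is_numeral mem k x"
proof (induction k arbitrary: x)
  case 0
  show ?case by (simp add: is_empty_\<pi>)
next
  case (Suc k)
  have "is_numeral mem_\<pi> (Suc k) x \<longleftrightarrow> is_numeral mem (Suc k) (\<pi> x)"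
    using is_succ_\<pi> \<pi>_not_wide[OF not_wide_numeral] by (auto simp: Suc)
  also have "\<dots> \<longleftrightarrow> is_numeral mem (Suc k) x"
    by (rule not_wide_\<pi>) (rule not_wide_numeral)
  finally show ?case .
qed

text \<open>\<open>w\<close> and all its elements are fixed, so the successor relation on
  \<open>w\<close> is the same in both models.\<close>

lemma omega_is_omega_\<pi>:
  assumes w: "is_omega mem w"
  shows "is_omega mem_\<pi> w"
proof -
  have fixed: "\<pi> w = w" "\<And>x. x \<epsilon> w \<Longrightarrow> \<pi> x = x"
    using \<pi>_not_wide not_wide_omega not_wide_natural w by blast+
  have "y \<epsilon> w" if x: "x \<epsilon> w" and y: "is_succ mem_\<pi> x y" for x y
  proof -
    have "is_succ mem x (\<pi> y)"
      using is_succ_\<pi>[of x y] fixed(2)[OF x] y by simp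
    then have "\<pi> y \<epsilon> w" by (rule succ_in_omega[OF w x])
    \<comment> \<open>As an element of \<open>w\<close>, the set \<open>\<pi> y\<close> is fixed,
      and injectivity then gives \<open>\<pi> y = y\<close>.\<close>
    then show ?thesis using fixed(2) \<pi>_eq_iff by metis
  qed
  then have "is_inductive mem_\<pi> w"
    using empty_in_omega[OF w]
    unfolding is_inductive_def is_empty_\<pi> permuted_iff fixed(1) by meson
  moreover have "subset_of mem_\<pi> w u" if u: "is_inductive mem_\<pi> u" for u
  proof -
    have "n \<epsilon> \<pi> u" if "n \<epsilon> w" for n
    proof -
      have empty: "x \<epsilon> \<pi> u" if "is_empty mem x" for x
        using u that by (simp add: is_inductive_def is_empty_\<pi> permuted_iff)
      have succ: "y \<epsilon> \<pi> u" if x: "x \<epsilon> w" "x \<epsilon> \<pi> u" and y: "is_succ mem x y" for x y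
      proof -
        have "\<pi> x = x" "\<pi> y = y"
          using fixed(2) x(1) succ_in_omega[OF w x(1) y] by simp_all
        then have "is_succ mem_\<pi> x y"
          using y by (simp add: is_succ_\<pi>)
        then show ?thesis
          using u x(2) unfolding is_inductive_def permuted_iff by blast
      qed
      \<comment> \<open>Induction along \<open>w\<close> takes the place of leastness:
        \<open>\<pi> u\<close> has been shown to be closed under successors in V only at elements of
        \<open>w\<close>.\<close>
      show ?thesis
        using omega_induct[OF w that, of "\<lambda>_. \<pi> u" "MemF 0 1"] empty succ by simp
    qed
    then show ?thesis
      by (simp add: subset_of_def permuted_iff fixed(1))
  qed
  ultimately show ?thesis unfolding is_omega_def by blast
qed

text \<open>Two least inductive sets of the permuted model include each other. Inclusion there
  concerns the images under \<open>\<pi>\<close>, so Extensionality is applied to these.\<close>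

lemma is_omega_\<pi>: "is_omega mem_\<pi> w \<longleftrightarrow> is_omega mem w"
proof
  obtain w0 where w0: "is_omega mem w0" using ex_omega by blast
  assume w: "is_omega mem_\<pi> w"
  have "\<pi> w = \<pi> w0"
    using w omega_is_omega_\<pi>[OF w0] ext
    unfolding is_omega_def subset_of_def permuted_iff by blast
  then show "is_omega mem w" using w0 by simp
qed (rule omega_is_omega_\<pi>)

lemma is_natural_\<pi>: "is_natural mem_\<pi> n \<longleftrightarrow> is_natural mem n"
  using \<pi>_not_wide[OF not_wide_omega] by (auto simp: is_natural_def is_omega_\<pi> permuted_iff)

section \<open>Functions and the coded language\<close>

lemma related_\<pi>: "related mem_\<pi> r x y \<longleftrightarrow> related mem (\<pi> r) x y"
  by (simp add: related_def is_pair_\<pi> permuted_iff)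

lemma is_relation_\<pi>: "is_relation mem_\<pi> r D C \<longleftrightarrow> is_relation mem (\<pi> r) (\<pi> D) (\<pi> C)"
  by (simp add: is_relation_def is_pair_\<pi> permuted_iff)

lemma is_function_\<pi>: "is_function mem_\<pi> f D C \<longleftrightarrow> is_function mem (\<pi> f) (\<pi> D) (\<pi> C)"
  by (simp add: is_function_def is_relation_\<pi> related_\<pi> permuted_iff)

lemma is_variable_\<pi>: "is_variable mem_\<pi> n t \<longleftrightarrow> is_variable mem n t"
  unfolding is_variable_def is_natural_\<pi> is_numeral_\<pi> is_pair_\<pi> ..

lemma is_constant_\<pi>: "is_constant mem_\<pi> A a t \<longleftrightarrow> is_constant mem (\<pi> A) a t"
  unfolding is_constant_def is_numeral_\<pi> is_pair_\<pi> permuted_iff ..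

lemma is_term_\<pi>: "is_term mem_\<pi> A t \<longleftrightarrow> is_term mem (\<pi> A) t"
  by (simp add: is_term_def is_variable_\<pi> is_constant_\<pi>)

lemma formula_constructors_\<pi>:
  "is_Equal mem_\<pi> t u x \<longleftrightarrow> is_Equal mem t u x"
  "is_Not mem_\<pi> y x \<longleftrightarrow> is_Not mem y x"
  "is_And mem_\<pi> y z x \<longleftrightarrow> is_And mem y z x"
  "is_Exists mem_\<pi> n y x \<longleftrightarrow> is_Exists mem n y x"
  "is_U mem_\<pi> t x \<longleftrightarrow> is_U mem t x"
  "is_R mem_\<pi> t u x \<longleftrightarrow> is_R mem t u x"
  unfolding is_Equal_def is_Not_def is_And_def is_Exists_def is_U_def is_R_def
    is_numeral_\<pi> is_pair_\<pi> is_triple_\<pi> is_variable_\<pi> by (rule refl)+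

lemma formula_closed_\<pi>: "formula_closed mem_\<pi> A F \<longleftrightarrow> formula_closed mem (\<pi> A) (\<pi> F)"
  by (simp add: formula_closed_def formula_constructors_\<pi> is_term_\<pi> permuted_iff)

text \<open>The competing closed sets \<open>G\<close> turn into \<open>\<pi> G\<close>, and these
  again range over all sets.\<close>

lemma is_formula_set_\<pi>: "is_formula_set mem_\<pi> A F \<longleftrightarrow> is_formula_set mem (\<pi> A) (\<pi> F)"
  unfolding is_formula_set_def formula_closed_\<pi> subset_of_\<pi>
  using all_\<pi>[of "\<lambda>G. formula_closed mem (\<pi> A) G \<longrightarrow> subset_of mem (\<pi> F) G"] by simp

section \<open>Structures, assignments, satisfaction and their transport\<close>

lemma is_structure_\<pi>:
  "is_structure mem_\<pi> A M U R I S \<longleftrightarrow>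
     is_quadruple mem M U R I S \<and> subset_of mem (\<pi> U) (\<pi> M) \<and>
     is_relation mem (\<pi> R) (\<pi> M) (\<pi> M) \<and> is_function mem (\<pi> I) (\<pi> A) (\<pi> M)"
  by (simp add: is_structure_def is_quadruple_\<pi> subset_of_\<pi> is_relation_\<pi> is_function_\<pi>)

lemma assignment_fixed: "is_assignment mem M s \<Longrightarrow> \<pi> s = s"
  using not_wide_assignment \<pi>_not_wide by blast

lemma is_assignment_\<pi>: "is_assignment mem_\<pi> M s \<longleftrightarrow> is_assignment mem (\<pi> M) s"
proof -
  have "is_assignment mem_\<pi> M s \<longleftrightarrow> is_assignment mem (\<pi> M) (\<pi> s)"
    by (simp add: is_assignment_def is_natural_\<pi> is_pair_\<pi> related_\<pi> permuted_iff)
  also have "\<dots> \<longleftrightarrow> is_assignment mem (\<pi> M) s"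
    by (rule not_wide_\<pi>) (rule not_wide_assignment)
  finally show ?thesis .
qed

text \<open>The notion consults the elements of \<open>s\<close> and \<open>s'\<close>. The latter
  is fixed because it is an assignment; for \<open>s\<close> this is assumed.\<close>

lemma is_update_\<pi>:
  "\<pi> s = s \<Longrightarrow> is_update mem_\<pi> M s n a s' \<longleftrightarrow> is_update mem (\<pi> M) s n a s'"
  using assignment_fixed[of "\<pi> M" s']
  by (auto simp: is_update_def is_assignment_\<pi> related_\<pi>)

lemma is_value_\<pi>:
  "\<pi> s = s \<Longrightarrow> is_value mem_\<pi> A I s t a \<longleftrightarrow> is_value mem (\<pi> A) (\<pi> I) s t a"
  by (simp add: is_value_def is_variable_\<pi> is_constant_\<pi> related_\<pi>)

lemma is_composition_\<pi>:
  "\<pi> s = s \<Longrightarrow> is_composition mem_\<pi> N f s s' \<longleftrightarrow> is_composition mem (\<pi> N) (\<pi> f) s s'"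
  using assignment_fixed[of "\<pi> N" s']
  by (auto simp: is_composition_def is_assignment_\<pi> related_\<pi>)

lemma is_satisfaction_\<pi>:
  "is_satisfaction mem_\<pi> A F M U R I T \<longleftrightarrow>
     is_satisfaction mem (\<pi> A) (\<pi> F) (\<pi> M) (\<pi> U) (\<pi> R) (\<pi> I) (\<pi> T)"
  unfolding is_satisfaction_def
proof (intro iff_allI imp_cong, goal_cases)
  case 1
  show ?case by (simp add: permuted_iff is_assignment_\<pi>)
next
  case (2 x s)
  \<comment> \<open>The premise that \<open>s\<close> is an assignment makes it fixed, as the rules
    for values and updates require.\<close>
  then have "\<pi> s = s" using assignment_fixed by blast
  then show ?case
    by (simp add: permuted_iff formula_constructors_\<pi> related_\<pi> is_value_\<pi> is_update_\<pi>)
qed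

text \<open>The graph of the map on structures, kept as a relation because the map is defined on
  quadruples only.\<close>

definition transported :: "'v \<Rightarrow> 'v \<Rightarrow> bool" where
  "transported S S' \<longleftrightarrow> (\<exists>M U R I. is_quadruple mem M U R I S \<and>
     is_quadruple mem (\<pi> M) (\<pi> U) (\<pi> R) (\<pi> I) S')"

lemma transported_sym: "transported S S' \<Longrightarrow> transported S' S"
  unfolding transported_def by (metis \<pi>_\<pi>)

lemma transported_unique: "transported S S' \<Longrightarrow> transported S S'' \<Longrightarrow> S' = S''"
  unfolding transported_def using quadruple_inject quadruple_unique by metis

lemma transported_inject: "transported S S'' \<Longrightarrow> transported S' S'' \<Longrightarrow> S = S'"
  using transported_sym transported_unique by blast

lemma transported_structure:
  assumes "transported S S'"
  shows "is_structure mem_\<pi> A M U R I S \<longleftrightarrow>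
    is_structure mem (\<pi> A) (\<pi> M) (\<pi> U) (\<pi> R) (\<pi> I) S'"
proof -
  have "is_quadruple mem M U R I S \<longleftrightarrow> is_quadruple mem (\<pi> M) (\<pi> U) (\<pi> R) (\<pi> I) S'"
    using assms unfolding transported_def by (metis quadruple_inject \<pi>_\<pi>)
  then show ?thesis
    unfolding is_structure_\<pi> by (simp add: is_structure_def)
qed

text \<open>Since \<open>\<pi>\<close> is an involution, the permuted model reads
  \<open>\<pi> F\<close>, \<open>\<pi> T\<close> and \<open>\<pi> f\<close> as V reads
  \<open>F\<close>, \<open>T\<close> and \<open>f\<close>. Codes of formulas occur as elements and
  assignments are fixed, so neither changes.\<close>

lemma elementary_embedding_transported:
  assumes S: "transported S\<^sub>1 S\<^sub>1'" "transported S\<^sub>2 S\<^sub>2'"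
    and f: "elementary_embedding mem (\<pi> A) S\<^sub>1' S\<^sub>2' f"
  shows "elementary_embedding mem_\<pi> A S\<^sub>1 S\<^sub>2 (\<pi> f)"
proof -
  obtain M U R I M' U' R' I' F T T' where *:
    "is_structure mem (\<pi> A) M U R I S\<^sub>1'" "is_structure mem (\<pi> A) M' U' R' I' S\<^sub>2'"
    "is_function mem f M M'" "is_formula_set mem (\<pi> A) F"
    "is_satisfaction mem (\<pi> A) F M U R I T" "is_satisfaction mem (\<pi> A) F M' U' R' I' T'"
    "\<And>x s s'. x \<epsilon> F \<Longrightarrow> is_assignment mem M s \<Longrightarrow> is_composition mem M' f s s' \<Longrightarrow>
      related mem T x s \<longleftrightarrow> related mem T' x s'"
    using f unfolding elementary_embedding_def by blast
  have "related mem_\<pi> (\<pi> T) x s \<longleftrightarrow> related mem_\<pi> (\<pi> T') x s'"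
    if "mem_\<pi> x (\<pi> F)" "is_assignment mem_\<pi> (\<pi> M) s" "is_composition mem_\<pi> (\<pi> M') (\<pi> f) s s'"
    for x s s'
    using that *(7) assignment_fixed[of M s]
    by (simp add: permuted_iff is_assignment_\<pi> is_composition_\<pi> related_\<pi>)
  moreover have "is_structure mem_\<pi> A (\<pi> M) (\<pi> U) (\<pi> R) (\<pi> I) S\<^sub>1"
    "is_structure mem_\<pi> A (\<pi> M') (\<pi> U') (\<pi> R') (\<pi> I') S\<^sub>2"
    using * by (simp_all add: transported_structure[OF S(1)] transported_structure[OF S(2)])
  moreover have "is_function mem_\<pi> (\<pi> f) (\<pi> M) (\<pi> M')" "is_formula_set mem_\<pi> A (\<pi> F)"
    "is_satisfaction mem_\<pi> A (\<pi> F) (\<pi> M) (\<pi> U) (\<pi> R) (\<pi> I) (\<pi> T)"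
    "is_satisfaction mem_\<pi> A (\<pi> F) (\<pi> M') (\<pi> U') (\<pi> R') (\<pi> I') (\<pi> T')"
    using * by (simp_all add: is_function_\<pi> is_formula_set_\<pi> is_satisfaction_\<pi>)
  ultimately show ?thesis unfolding elementary_embedding_def by blast
qed


section \<open>Transfer of Vopenka's Principle\<close>

definition transportedF :: "nat \<Rightarrow> nat \<Rightarrow> nat \<Rightarrow> set_fm" where
  "transportedF i j n =
     ExF n (ExF (n + 1) (ExF (n + 2) (ExF (n + 3)
       (ExF (n + 4) (ExF (n + 5) (ExF (n + 6) (ExF (n + 7)
         (ConjF (quadrupleF n (n + 1) (n + 2) (n + 3) i (n + 8))
           (ConjF (quadrupleF (n + 4) (n + 5) (n + 6) (n + 7) j (n + 8))
             (ConjF (ConjF (swapF n (n + 4) (n + 8)) (swapF (n + 1) (n + 5) (n + 8)))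
               (ConjF (swapF (n + 2) (n + 6) (n + 8)) (swapF (n + 3) (n + 7) (n + 8)))))))))))))"

lemma holds_transportedF [simp]:
  "\<lbrakk>i < n; j < n\<rbrakk> \<Longrightarrow> holds mem e (transportedF i j n) \<longleftrightarrow> transported (e i) (e j)"
  by (simp add: transportedF_def transported_def)

text \<open>Interprets the permuted model in V. One variable \<open>n\<close> serves for all atoms,
  because each of its quantifiers encloses a single atom.\<close>

primrec permutedF :: "nat \<Rightarrow> set_fm \<Rightarrow> set_fm" where
  "permutedF n (EqF i j) = EqF i j"
| "permutedF n (MemF i j) = ExF n (ConjF (swapF j n (n + 1)) (MemF i n))"
| "permutedF n (NegF \<phi>) = NegF (permutedF n \<phi>)"
| "permutedF n (ConjF \<phi> \<psi>) = ConjF (permutedF n \<phi>) (permutedF n \<psi>)"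
| "permutedF n (ExF i \<phi>) = ExF i (permutedF n \<phi>)"

lemma holds_permutedF:
  "var_bound \<phi> \<le> n \<Longrightarrow> holds mem e (permutedF n \<phi>) \<longleftrightarrow> holds mem_\<pi> e \<phi>"
  by (induction \<phi> arbitrary: e) (auto simp: permuted_iff)

lemma transported_class_definable:
  obtains \<psi> where "\<And>S'. holds mem (e(0 := S')) \<psi> \<longleftrightarrow>
    (\<exists>S. holds mem_\<pi> (e(0 := S)) \<phi> \<and> transported S S')"
proof
  \<comment> \<open>Positive and beyond the variables of \<open>\<phi>\<close>, so that
    \<open>n\<close> can store a value while variable 0 is reused.\<close>
  define n where "n = Suc (var_bound \<phi>)"
  have "holds mem_\<pi> (e(n := S', 0 := S)) \<phi> \<longleftrightarrow> holds mem_\<pi> (e(0 := S)) \<phi>" for S S'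
    by (rule holds_cong) (simp add: n_def)
  \<comment> \<open>Variable 0 is \<open>S'\<close> outside and \<open>S\<close> inside, so
    \<open>S'\<close> is first saved in variable \<open>n\<close>.\<close>
  then show "holds mem (e(0 := S'))
      (ExF n (ConjF (EqF n 0) (ExF 0 (ConjF (permutedF n \<phi>) (transportedF 0 n (n + 1)))))) \<longleftrightarrow>
    (\<exists>S. holds mem_\<pi> (e(0 := S)) \<phi> \<and> transported S S')" for S'
    by (simp add: holds_permutedF n_def fun_upd_twist)
qed

text \<open>If the images formed a set, then Replacement along the inverse of the injection would
  make \<open>X\<close> a set as well.\<close>

lemma proper_class_transported:
  assumes X: "proper_class mem_\<pi> X" and transp: "\<And>S. X S \<Longrightarrow> \<exists>S'. transported S S'"
  shows "proper_class mem (\<lambda>S'. \<exists>S. X S \<and> transported S S')"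
proof (rule ccontr)
  assume "\<not> ?thesis"
  then obtain y where y: "\<And>S'. S' \<epsilon> y \<longleftrightarrow> (\<exists>S. X S \<and> transported S S')"
    unfolding proper_class_def by blast
  \<comment> \<open>Variable 0 runs through \<open>y\<close>, and variable 1 is the
    preimage.\<close>
  obtain b where b: "\<And>S. S \<epsilon> b \<longleftrightarrow> (\<exists>S'. S' \<epsilon> y \<and> transported S S')"
    using replacement[of y undefined "transportedF 1 0 2"] transported_inject by auto
  have "X S \<longleftrightarrow> S \<epsilon> b" for S
    unfolding b y using transp transported_inject by blast
  \<comment> \<open>In the permuted model the elements of \<open>\<pi> b\<close> are exactly those
    of \<open>b\<close>, so \<open>X\<close> would be a set there too.\<close>
  then show False
    using X unfolding proper_class_def permuted_iff by (metis \<pi>_\<pi>)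
qed

lemma VP_\<pi>:
  assumes "VP mem"
  shows "VP mem_\<pi>"
  unfolding VP_def Let_def
proof (intro allI impI)
  fix \<phi> e A
  define X where "X S = holds mem_\<pi> (e(0 := S)) \<phi>" for S
  assume "proper_class mem_\<pi> (\<lambda>S. holds mem_\<pi> (e(0 := S)) \<phi>) \<and>
    (\<forall>S. holds mem_\<pi> (e(0 := S)) \<phi> \<longrightarrow> (\<exists>M U R I. is_structure mem_\<pi> A M U R I S))"
  then have X: "proper_class mem_\<pi> X" "\<And>S. X S \<Longrightarrow> \<exists>M U R I. is_structure mem_\<pi> A M U R I S"
    unfolding X_def by blast+
  define Y where "Y S' = (\<exists>S. X S \<and> transported S S')" for S'
  obtain \<psi> where \<psi>: "\<And>S'. holds mem (e(0 := S')) \<psi> \<longleftrightarrow> Y S'"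
    using transported_class_definable[of e \<phi>] unfolding Y_def X_def by blast
  have "\<exists>S'. transported S S'" if "X S" for S
    using X(2)[OF that] ex_quadruple unfolding is_structure_\<pi> transported_def by metis
  then have "proper_class mem Y"
    using proper_class_transported[OF X(1)] unfolding Y_def by simp
  moreover have "\<exists>M U R I. is_structure mem (\<pi> A) M U R I S'" if "Y S'" for S'
    using that X(2) transported_structure unfolding Y_def by blast
  \<comment> \<open>The index set is \<open>\<pi> A\<close>, because the permuted model takes its
    constants from the elements of \<open>\<pi> A\<close>.\<close>
  ultimately obtain S\<^sub>1' S\<^sub>2' f where
    "Y S\<^sub>1'" "Y S\<^sub>2'" "S\<^sub>1' \<noteq> S\<^sub>2'" and f: "elementary_embedding mem (\<pi> A) S\<^sub>1' S\<^sub>2' f"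
    using assms[unfolded VP_def Let_def, rule_format, of e \<psi> "\<pi> A"] unfolding \<psi> by blast
  then obtain S\<^sub>1 S\<^sub>2 where S: "X S\<^sub>1" "X S\<^sub>2" "transported S\<^sub>1 S\<^sub>1'" "transported S\<^sub>2 S\<^sub>2'"
    unfolding Y_def by blast
  moreover have "S\<^sub>1 \<noteq> S\<^sub>2"
    using S(3,4) \<open>S\<^sub>1' \<noteq> S\<^sub>2'\<close> transported_unique by blast
  moreover have "elementary_embedding mem_\<pi> A S\<^sub>1 S\<^sub>2 (\<pi> f)"
    using S(3,4) f by (rule elementary_embedding_transported)
  ultimately show "\<exists>S S' f. holds mem_\<pi> (e(0 := S)) \<phi> \<and> holds mem_\<pi> (e(0 := S')) \<phi> \<and> S \<noteq> S' \<and>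
      elementary_embedding mem_\<pi> A S S' f"
    unfolding X_def by blast
qed

end

theorem theorem3p2:
  fixes mem :: "'v \<Rightarrow> 'v \<Rightarrow> bool"
  assumes "ZF mem" and "VP mem"
  shows "\<exists>\<pi>. definable_permutation mem \<pi> \<and>
             VP (permuted mem \<pi>) \<and> \<not> Foundation (permuted mem \<pi>)"
proof -
  interpret zf_model mem by standard (rule assms(1))
  obtain p where "is_level mem 3 p" using ex_level by blast
  moreover obtain q where "is_power mem p q" using ex_power by blast
  ultimately interpret level_swap mem p q by unfold_locales
  show ?thesis
    using definable_permutation_\<pi> VP_\<pi>[OF assms(2)] not_Foundation_\<pi> by blast
qed

end
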